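(* Let $(z^\ast,\mu^\ast,\lambda^\ast)$ be the KKT point of the problem $\min\{J(z) : H(z)=0,\ z\in\mathcal{Z}\}$ fixed in the context, and let $\kappa,\nu>0$ be the constants described there. Let $\{z_k\}\subset\mathbb{R}^n$ and $\{\mu_k\}\subset\mathbb{R}^r$ be sequences such that for all $k$ $$z_k\in\mathcal{Z}\cap \operatorname{cl}\big(\mathcal{B}(z^\ast,\min\{\kappa,\nu\})\big),\qquad -\nabla_z L_{\rho_k}(z_k,\mu_k)\in\mathcal{N}_{\mathcal{Z}}(z_k)+d_k ,$$ where - $\{\rho_k\}\subset(0,+\infty)$ is increasing and $\rho_k\to+\infty$; - $\{\mu_k\}$ and $\{\lambda_k\}$ are bounded, where $\lambda_k\in\mathbb{R}^q$ is a multiplier associated with the normal cone $\mathcal{N}_{\mathcal{Z}}(z_k)$, i.e. $-\nabla_z L_{\rho_k}(z_k,\mu_k)-d_k=A^\top\lambda_k$ with $\lambda_k\ge 0$ and $\lambda_k^\top(b-Az_k)=0$; - $d_k\in\mathbb{R}^n$ and $\|d_k\|_2\to 0$. Assume that all limit points of $\{z_k\}$ are regular (a point $x\in\mathbb{R}^n$ with $H(x)=0$ is called regular if the gradients $\nabla H_1(x),\ldots,\nabla H_r(x)$ are linearly independent). Then $z_k\to z^\ast$ and $\tilde\mu_k\to\mu^\ast$, where $\tilde\mu_k:=\mu_k+\rho_kH(z_k)$.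
   Context: Setting. Let $N\ge 1$, $n=\sum_{i=1}^N n_i$, $z=(z_1,\ldots,z_N)\in\mathbb{R}^n$ with $z_i\in\mathbb{R}^{n_i}$. Let $J(z)=\sum_{i=1}^N J_i(z_i)+Q(z)$ with $J_i:\mathbb{R}^{n_i}\to\mathbb{R}$, $Q:\mathbb{R}^n\to\mathbb{R}$, and $H(z)=(F_1(z_1)^\top,\ldots,F_N(z_N)^\top,G(z)^\top)^\top\in\mathbb{R}^r$ with $F_i:\mathbb{R}^{n_i}\to\mathbb{R}^{m_i}$, $G:\mathbb{R}^n\to\mathbb{R}^p$, $r=\sum_i m_i+p$. The functions $J_i,Q,F_i,G$ are twice continuously differentiable and semi-algebraic. For each $i$, $\mathcal{Z}_i=\{x\in\mathbb{R}^{n_i}: A_ix\le b_i\}$ is a (bounded) polytope, with $A_i\in\mathbb{R}^{q_i\times n_i}$, $b_i\in\mathbb{R}^{q_i}$; $\mathcal{Z}=\mathcal{Z}_1\times\cdots\times\mathcal{Z}_N=\{x\in\mathbb{R}^n: Ax\le b\}$ with $A=\operatorname{blkdiag}(A_1,\ldots,A_N)\in\mathbb{R}^{q\times n}$, $b=(b_1^\top,\ldots,b_N^\top)^\top\in\mathbb{R}^q$, $q=\sum_i q_i$. Augmented Lagrangian: for $\rho>0$, $\mu\in\mathbb{R}^r$, $L_\rho(z,\mu)=J(z)+\mu^\top H(z)+\frac{\rho}{2}\|H(z)\|_2^2$; $\nabla_z L_\rho$ is its gradient in $z$. Normal cone: for a convex set $\Omega\subset\mathbb{R}^n$ and $\bar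 x\in\Omega$, $\mathcal{N}_\Omega(\bar x)=\{v\in\mathbb{R}^n: v^\top(x-\bar x)\le 0\ \forall x\in\Omega\}$. $\mathcal{B}(x,t)$ is the open Euclidean ball of radius $t$ centred at $x$, and $\operatorname{cl}$ denotes the closure. KKT point: a triple $(z,\mu,\lambda)\in\mathbb{R}^{n+r+q}$ with $H(z)=0$, $Az\le b$, $\nabla J(z)+DH(z)^\top\mu+A^\top\lambda=0$, $\lambda\ge0$, $\lambda^\top(b-Az)=0$, where $DH$ is the Jacobian of $H$. Standing assumption on $(z^\ast,\mu^\ast,\lambda^\ast)$: it is an isolated KKT point of the problem such that (i) $z^\ast$ is regular, in the sense defined in the claim; (ii) with $L(z,\mu,\lambda)=J(z)+\mu^\top H(z)+\lambda^\top(Az-b)$ and $I^\ast\subseteq\{1,\ldots,q\}$ the set of indices of inequality constraints active at $z^\ast$, $p^\top\nabla^2_{zz}L(z^\ast,\mu^\ast,\lambda^\ast)p>0$ for all $p\in\mathbb{R}^n$, $p\ne0$, with $DH(z^\ast)p=0$ and $A_{I^\ast}p=0$ ($A_{I^\ast}$: rows of $A$ indexed by $I^\ast$); (iii) $\lambda^\ast_i>0$ for all $i\in I^\ast$. Constants: $\nu>0$ is such that $z^\ast$ is the only critical point of the problem (i.e. the only $z$-component of a KKT triple) in the open ball $\mathcal{B}(z^\ast,\nu)$. $\kappa>0$ is a constant for which there exist $\delta,\bar\rho>0$ such that, for all $(\mu,\rho)\in\mathbb{R}^{r}\times\mathbb{R}$ with $\|\mu-\mu^\ast\|_2\le\delta\rho$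 and $\rho\ge\bar\rho$, the problem of minimising $L_\rho(\cdot,\mu)$ over $\{z\in\mathcal{Z}:\|z-z^\ast\|_2<\kappa\}$ has a unique minimiser.
   Formalization: The formal theorem additionally assumes that no critical point lies on the sphere of radius min{κ,ν} about z*; as stated the claim fails when ν ≤ κ, since the z_k may stay at another regular critical point on that sphere. *)

theory Defs
  imports "HOL-Analysis.Analysis"
begin

text \<open>
  Block structure. The coordinates of \<open>z\<close>, the rows of \<open>H\<close> and the rows of \<open>A\<close> are indexed by
  finite types \<open>'n\<close>, \<open>'r\<close>, \<open>'q\<close>, and the blocks by \<open>'b\<close>. The maps \<open>nb :: 'n \<Rightarrow> 'b\<close> and
  \<open>qb :: 'q \<Rightarrow> 'b\<close> assign coordinates and rows of \<open>A\<close> to blocks; \<open>rb :: 'r \<Rightarrow> 'b option\<close> sends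
  the rows of \<open>F i\<close> to \<open>Some i\<close> and those of the coupling constraint \<open>G\<close> to \<open>None\<close>.
  A space such as \<open>R^{n_i}\<close> is the coordinate subspace of \<open>real^'n\<close> of the vectors that vanish
  outside block \<open>i\<close>; values of \<open>J i\<close>, \<open>F i\<close> off that subspace are never used.
\<close>

definition coords :: "'i set \<Rightarrow> real^'i \<Rightarrow> real^'i::finite" where
  "coords S x = (\<chi> i. if i \<in> S then x $ i else 0)"

definition block :: "('i \<Rightarrow> 'b) \<Rightarrow> 'b \<Rightarrow> 'i set" where
  "block f i = {j. f j = i}"

definition objective ::
  "('n \<Rightarrow> 'b) \<Rightarrow> ('b \<Rightarrow> real^'n \<Rightarrow> real) \<Rightarrow> (real^'n \<Rightarrow> real) \<Rightarrow> real^'n::finite \<Rightarrow> real" where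
  "objective nb Jb Q z = (\<Sum>i\<in>UNIV. Jb i (coords (block nb i) z)) + Q z"

definition constraint_map ::
  "('n \<Rightarrow> 'b) \<Rightarrow> ('r \<Rightarrow> 'b option) \<Rightarrow> ('b \<Rightarrow> real^'n \<Rightarrow> real^'r) \<Rightarrow> (real^'n \<Rightarrow> real^'r)
    \<Rightarrow> real^'n::finite \<Rightarrow> real^'r::finite" where
  "constraint_map nb rb F G z =
     (\<chi> k. case rb k of Some i \<Rightarrow> F i (coords (block nb i) z) $ k | None \<Rightarrow> G z $ k)"

definition blkdiag ::
  "('n \<Rightarrow> 'b) \<Rightarrow> ('q \<Rightarrow> 'b) \<Rightarrow> ('b \<Rightarrow> real^'n^'q) \<Rightarrow> real^'n::finite^'q::finite" where
  "blkdiag nb qb Ab = (\<chi> k j. if qb k = nb j then Ab (nb j) $ k $ j else 0)"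

definition blkstack :: "('q \<Rightarrow> 'b) \<Rightarrow> ('b \<Rightarrow> real^'q) \<Rightarrow> real^'q::finite" where
  "blkstack qb bb = (\<chi> k. bb (qb k) $ k)"

definition local_polytope ::
  "('n \<Rightarrow> 'b) \<Rightarrow> ('q \<Rightarrow> 'b) \<Rightarrow> ('b \<Rightarrow> real^'n^'q) \<Rightarrow> ('b \<Rightarrow> real^'q) \<Rightarrow> 'b
    \<Rightarrow> (real^'n::finite) set" where
  "local_polytope nb qb Ab bb i =
     {x. coords (block nb i) x = x \<and> (\<forall>k\<in>block qb i. (Ab i *v x) $ k \<le> bb i $ k)}"

definition product_polytope ::
  "('n \<Rightarrow> 'b) \<Rightarrow> ('q \<Rightarrow> 'b) \<Rightarrow> ('b \<Rightarrow> real^'n^'q) \<Rightarrow> ('b \<Rightarrow> real^'q) \<Rightarrow> (real^'n::finite) set" where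
  "product_polytope nb qb Ab bb =
     {z. \<forall>i. coords (block nb i) z \<in> local_polytope nb qb Ab bb i}"

definition twice_cont_differentiable ::
  "('a::real_normed_vector \<Rightarrow> 'c::real_normed_vector) \<Rightarrow> bool" where
  "twice_cont_differentiable f \<longleftrightarrow>
     (\<exists>(f' :: 'a \<Rightarrow> 'a \<Rightarrow>\<^sub>L 'c) (f'' :: 'a \<Rightarrow> 'a \<Rightarrow>\<^sub>L ('a \<Rightarrow>\<^sub>L 'c)).
        (\<forall>x. (f has_derivative blinfun_apply (f' x)) (at x)) \<and>
        (\<forall>x. (f' has_derivative blinfun_apply (f'' x)) (at x)) \<and>
        continuous_on UNIV f'')"

definition semialgebraic :: "'a::euclidean_space set \<Rightarrow> bool" where
  "semialgebraic S \<longleftrightarrow>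
     (\<exists>C :: (('a \<Rightarrow> real) set \<times> ('a \<Rightarrow> real) set) set. finite C \<and>
        (\<forall>(P, R)\<in>C. finite P \<and> finite R \<and> (\<forall>p\<in>P \<union> R. real_polynomial_function p)) \<and>
        S = (\<Union>(P, R)\<in>C. {x. (\<forall>p\<in>P. p x = 0) \<and> (\<forall>p\<in>R. p x > 0)}))"

definition semialgebraic_fun :: "('a::euclidean_space \<Rightarrow> 'c::euclidean_space) \<Rightarrow> bool" where
  "semialgebraic_fun f \<longleftrightarrow> semialgebraic {(x, f x) | x. True}"

definition smooth_semialgebraic :: "('a::euclidean_space \<Rightarrow> 'c::euclidean_space) \<Rightarrow> bool" where
  "smooth_semialgebraic f \<longleftrightarrow> twice_cont_differentiable f \<and> semialgebraic_fun f"

definition gradient :: "('a::real_inner \<Rightarrow> real) \<Rightarrow> 'a \<Rightarrow> 'a" where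
  "gradient f x = (THE D. GDERIV f x :> D)"

definition hessian :: "(real^'n \<Rightarrow> real) \<Rightarrow> real^'n \<Rightarrow> real^'n::finite^'n" where
  "hessian f x = jacobian (gradient f) (at x)"

definition aug_lagrangian ::
  "(real^'n \<Rightarrow> real) \<Rightarrow> (real^'n \<Rightarrow> real^'r) \<Rightarrow> real \<Rightarrow> real^'r::finite \<Rightarrow> real^'n::finite \<Rightarrow> real" where
  "aug_lagrangian J H \<rho> \<mu> z = J z + \<mu> \<bullet> H z + \<rho> / 2 * (norm (H z))\<^sup>2"

definition lagrangian ::
  "(real^'n \<Rightarrow> real) \<Rightarrow> (real^'n \<Rightarrow> real^'r) \<Rightarrow> real^'n^'q \<Rightarrow> real^'q
    \<Rightarrow> real^'r::finite \<Rightarrow> real^'q::finite \<Rightarrow> real^'n::finite \<Rightarrow> real" where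
  "lagrangian J H A b \<mu> lam z = J z + \<mu> \<bullet> H z + lam \<bullet> (A *v z - b)"

definition normal_cone :: "'a::real_inner set \<Rightarrow> 'a \<Rightarrow> 'a set" where
  "normal_cone S x = {v. \<forall>y\<in>S. v \<bullet> (y - x) \<le> 0}"

definition KKT_points ::
  "(real^'n \<Rightarrow> real) \<Rightarrow> (real^'n \<Rightarrow> real^'r) \<Rightarrow> real^'n^'q \<Rightarrow> real^'q
    \<Rightarrow> ((real^'n::finite) \<times> (real^'r::finite) \<times> (real^'q::finite)) set" where
  "KKT_points J H A b =
     {(z, \<mu>, lam). H z = 0 \<and> A *v z \<le> b \<and>
        gradient J z + transpose (jacobian H (at z)) *v \<mu> + transpose A *v lam = 0 \<and>
        0 \<le> lam \<and> lam \<bullet> (b - A *v z) = 0}"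

definition critical_points ::
  "(real^'n \<Rightarrow> real) \<Rightarrow> (real^'n \<Rightarrow> real^'r::finite) \<Rightarrow> real^'n^'q \<Rightarrow> real^'q::finite
    \<Rightarrow> (real^'n::finite) set" where
  "critical_points J H A b = fst ` KKT_points J H A b"

text \<open>
  Injectivity makes this the linear independence of the family of gradients; \<open>independent\<close> of the
  range alone would overlook repeated gradients.
\<close>

definition regular_point :: "(real^'n \<Rightarrow> real^'r) \<Rightarrow> real^'n::finite \<Rightarrow> bool" where
  "regular_point H x \<longleftrightarrow> H x = (0 :: real^'r::finite) \<and>
     inj (\<lambda>k. gradient (\<lambda>y. H y $ k) x) \<and> independent (range (\<lambda>k. gradient (\<lambda>y. H y $ k) x))"

definition active_set :: "real^'n^'q \<Rightarrow> real^'q \<Rightarrow> real^'n::finite \<Rightarrow> 'q::finite set" where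
  "active_set A b z = {k. (A *v z) $ k = b $ k}"

definition limit_point_of_seq :: "(nat \<Rightarrow> 'a::topological_space) \<Rightarrow> 'a \<Rightarrow> bool" where
  "limit_point_of_seq z x \<longleftrightarrow> (\<exists>s. strict_mono s \<and> (z \<circ> s) \<longlonglongrightarrow> x)"

text \<open>
  Pitfall: iterates in the closed ball of radius \<open>min \<kappa> \<nu>\<close> around \<open>zs\<close> may accumulate on its
  boundary sphere, whereas uniqueness of the critical point in the open ball of radius \<open>\<nu>\<close> says
  nothing about that sphere when \<open>\<nu> \<le> \<kappa>\<close>. Hence critical points on the sphere have to be excluded:
  for \<open>J = x^2/2 - x^3/3\<close>, \<open>H = y\<close> on \<open>[-2,2]^2\<close>, \<open>zs = (0,0)\<close> and \<open>\<kappa> = \<nu> = 1\<close>, the constant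
  sequence \<open>(1,0)\<close> with zero multipliers and errors satisfies everything else and does not
  converge to \<open>zs\<close>.
\<close>

end

theory Submission
  imports Defs
begin

text \<open>
  Stationarity reads \<open>\<nabla>J(z k) + DH(z k)\<^sup>T (\<mu> k + \<rho> k H(z k)) + A\<^sup>T lam k = - d k\<close>. Along a
  subsequence on which \<open>z\<close> and \<open>lam\<close> converge, regularity of the limit of \<open>z\<close> makes \<open>DH\<^sup>T\<close>
  injective there, which forces \<open>\<mu> k + \<rho> k H(z k)\<close> to converge too, and the limit triple is a KKT
  point. Its first component is \<open>zs\<close> by the choice of the radius. The KKT points over \<open>zs\<close> form a
  convex set, so an isolated one is the only one, which identifies the limiting multiplier.
\<close>

section \<open>Convergence of matrix products\<close>

lemma tendsto_matrix_vector_mult: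
  fixes M :: "'a \<Rightarrow> real^'n::finite^'m::finite"
  assumes "(M \<longlongrightarrow> M0) F" and "(x \<longlongrightarrow> x0) F"
  shows "((\<lambda>k. M k *v x k) \<longlongrightarrow> M0 *v x0) F"
  unfolding matrix_vector_mult_def by (intro tendsto_intros assms)

lemma tendsto_matrix_matrix_mult:
  fixes M :: "'a \<Rightarrow> real^'n::finite^'m::finite" and N :: "'a \<Rightarrow> real^'l::finite^'n"
  assumes "(M \<longlongrightarrow> M0) F" and "(N \<longlongrightarrow> N0) F"
  shows "((\<lambda>k. M k ** N k) \<longlongrightarrow> M0 ** N0) F"
  unfolding matrix_matrix_mult_def by (intro tendsto_intros assms)

lemma tendsto_transpose:
  fixes M :: "'a \<Rightarrow> real^'n::finite^'m::finite"
  assumes "(M \<longlongrightarrow> M0) F"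
  shows "((\<lambda>k. transpose (M k)) \<longlongrightarrow> transpose M0) F"
  unfolding transpose_def by (intro tendsto_intros assms)

text \<open>The sum of the row norms stands in for the operator norm: it is a continuous expression
  in the entries, so it visibly tends to 0 when the matrix does.\<close>

lemma norm_matrix_vector_mult_le_sum_rows:
  fixes M :: "real^'n::finite^'m::finite"
  shows "norm (M *v x) \<le> (\<Sum>i\<in>UNIV. norm (M $ i)) * norm x"
proof -
  have "norm (M *v x) \<le> (\<Sum>i\<in>UNIV. \<bar>(M *v x) $ i\<bar>)"
    by (rule norm_le_l1_cart)
  also have "\<dots> \<le> (\<Sum>i\<in>UNIV. norm (M $ i) * norm x)"
    by (intro sum_mono) (simp add: matrix_vector_mul_component Cauchy_Schwarz_ineq2)
  finally show ?thesis by (simp add: sum_distrib_right)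
qed

text \<open>With \<open>P\<close> a left inverse of \<open>M0\<close>, the vectors
  \<open>y k = P *v (M k *v x k)\<close> converge, and
  \<open>x k - y k = (mat 1 - P ** M k) *v x k\<close> has a coefficient matrix tending to 0.
  Boundedness of \<open>x\<close> is not presupposed; it comes out of the estimate. This is how
  multiplier estimates that might blow up with the penalty are controlled.\<close>

lemma tendsto_of_matrix_vector_mult_tendsto:
  fixes M :: "'a \<Rightarrow> real^'n::finite^'m::finite"
  assumes M: "(M \<longlongrightarrow> M0) F" and inj: "inj ((*v) M0)"
    and Mx: "((\<lambda>k. M k *v x k) \<longlongrightarrow> c) F"
  shows "\<exists>x0. (x \<longlongrightarrow> x0) F"
proof -
  obtain P where P: "P ** M0 = mat 1"
    using inj matrix_left_invertible_injective[of M0] by blast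
  define e where "e k = (\<Sum>i\<in>UNIV. norm ((mat 1 - P ** M k) $ i))" for k
  define y where "y k = P *v (M k *v x k)" for k
  have y: "(y \<longlongrightarrow> P *v c) F"
    unfolding y_def by (intro tendsto_matrix_vector_mult tendsto_const Mx)
  have "((\<lambda>k. P ** M k) \<longlongrightarrow> mat 1) F"
    using tendsto_matrix_matrix_mult[OF tendsto_const M, of P] P by simp
  then have "(e \<longlongrightarrow> (\<Sum>i\<in>UNIV. norm ((mat 1 - mat 1 :: real^'n^'n) $ i))) F"
    unfolding e_def by (intro tendsto_intros)
  then have e: "(e \<longlongrightarrow> 0) F" by simp
  have diff: "norm (x k - y k) \<le> e k * norm (x k)" for k
  proof -
    have "x k - y k = (mat 1 - P ** M k) *v x k"
      by (simp add: y_def matrix_vector_mult_diff_rdistrib matrix_vector_mul_assoc)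
    then show ?thesis
      unfolding e_def by (metis norm_matrix_vector_mult_le_sum_rows)
  qed
  have "\<forall>\<^sub>F k in F. e k < 1/2"
    using e by (rule order_tendstoD) simp
  then have "\<forall>\<^sub>F k in F. norm (x k - y k) \<le> e k * (2 * norm (y k))"
  proof (rule eventually_mono)
    \<comment> \<open>Once the error factor is below 1/2, the triangle inequality absorbs the error
      into \<open>norm (x k)\<close>. This bounds \<open>x k\<close> by twice the convergent
      \<open>y k\<close>.\<close>
    fix k assume "e k < 1/2"
    have "0 \<le> e k" by (simp add: e_def sum_nonneg)
    have "norm (x k) \<le> norm (y k) + norm (x k - y k)"
      by (rule norm_triangle_sub)
    also have "\<dots> \<le> norm (y k) + 1/2 * norm (x k)"
      using diff[of k] \<open>e k < 1/2\<close> mult_right_mono[of "e k" "1/2" "norm (x k)"] by simp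
    finally have "norm (x k) \<le> 2 * norm (y k)" by simp
    then show "norm (x k - y k) \<le> e k * (2 * norm (y k))"
      using diff[of k] \<open>0 \<le> e k\<close> by (meson mult_left_mono order_trans)
  qed
  moreover have "((\<lambda>k. e k * (2 * norm (y k))) \<longlongrightarrow> 0 * (2 * norm (P *v c))) F"
    by (intro tendsto_intros e y)
  ultimately have "((\<lambda>k. x k - y k) \<longlongrightarrow> 0) F"
    using Lim_null_comparison[of "\<lambda>k. x k - y k"] by simp
  from tendsto_add[OF this y] show ?thesis by auto
qed

text \<open>If convergence failed, infinitely many terms would stay at distance at least
  \<open>e\<close> from \<open>L\<close>. Listing their indices in increasing order gives a
  subsequence none of whose subsequences can tend to \<open>L\<close>.\<close>

lemma LIMSEQ_of_subsequences:
  fixes X :: "nat \<Rightarrow> 'a::metric_space"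
  assumes "\<And>s :: nat \<Rightarrow> nat. strict_mono s \<Longrightarrow> \<exists>t. strict_mono t \<and> (\<lambda>k. X (s (t k))) \<longlonglongrightarrow> L"
  shows "X \<longlonglongrightarrow> L"
proof (rule ccontr)
  assume "\<not> X \<longlonglongrightarrow> L"
  then obtain e where "e > 0" and "\<not> (\<forall>\<^sub>F k in sequentially. dist (X k) L < e)"
    unfolding tendsto_iff by blast
  then have inf: "infinite {k. \<not> dist (X k) L < e}"
    using cofinite_eq_sequentially eventually_cofinite by metis
  define s where "s = enumerate {k. \<not> dist (X k) L < e}"
  have "strict_mono s"
    unfolding s_def by (rule strict_mono_enumerate[OF inf])
  then obtain t where t: "(\<lambda>k. X (s (t k))) \<longlonglongrightarrow> L"
    using assms[OF \<open>strict_mono s\<close>] by blast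
  have "dist (X (s (t k))) L \<ge> e" for k
    using enumerate_in_set[OF inf, of "t k"] by (simp add: s_def not_less)
  moreover have "\<forall>\<^sub>F k in sequentially. dist (X (s (t k))) L < e"
    using t \<open>e > 0\<close> by (rule tendstoD)
  ultimately show False
    by (simp add: eventually_sequentially not_less[symmetric])
qed

section \<open>Gradients and Jacobians\<close>

text \<open>The derivative takes values in the bounded linear operators, so its continuity passes to
  the value at each \<open>axis i 1\<close> and hence to the entries of gradients and Jacobians. The
  class is closed under the finite sums that assemble \<open>J\<close> and \<open>H\<close> from
  their blocks.\<close>

definition cont_differentiable ::
  "('a::real_normed_vector \<Rightarrow> 'c::real_normed_vector) \<Rightarrow> bool" where
  "cont_differentiable f \<longleftrightarrow>
     (\<exists>f' :: 'a \<Rightarrow> 'a \<Rightarrow>\<^sub>L 'c.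
        (\<forall>x. (f has_derivative blinfun_apply (f' x)) (at x)) \<and> continuous_on UNIV f')"

lemma smooth_semialgebraic_imp_cont_differentiable:
  assumes "smooth_semialgebraic f"
  shows "cont_differentiable f"
proof -
  obtain f' :: "'a \<Rightarrow> 'a \<Rightarrow>\<^sub>L 'b" and f'' :: "'a \<Rightarrow> 'a \<Rightarrow>\<^sub>L ('a \<Rightarrow>\<^sub>L 'b)" where
    f': "\<And>x. (f has_derivative blinfun_apply (f' x)) (at x)"
    and f'': "\<And>x. (f' has_derivative blinfun_apply (f'' x)) (at x)"
    using assms unfolding smooth_semialgebraic_def twice_cont_differentiable_def by blast
  have "continuous_on UNIV f'"
    using f'' by (rule has_derivative_continuous_on)
  with f' show ?thesis unfolding cont_differentiable_def by blast
qed

lemma cont_differentiable_add: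
  assumes "cont_differentiable f" and "cont_differentiable g"
  shows "cont_differentiable (\<lambda>x. f x + g x)"
proof -
  obtain f' g' where
    "\<And>x. (f has_derivative blinfun_apply (f' x)) (at x)" "continuous_on UNIV f'"
    "\<And>x. (g has_derivative blinfun_apply (g' x)) (at x)" "continuous_on UNIV g'"
    using assms unfolding cont_differentiable_def by auto
  then show ?thesis
    unfolding cont_differentiable_def
    by (intro exI[of _ "\<lambda>x. f' x + g' x"])
      (auto intro!: continuous_on_add has_derivative_eq_rhs[OF has_derivative_add]
        simp: blinfun.add_left)
qed

lemma cont_differentiable_zero: "cont_differentiable (\<lambda>x. 0)"
  unfolding cont_differentiable_def
  by (rule exI[of _ "\<lambda>x. 0"]) (simp add: zero_blinfun.rep_eq)

lemma cont_differentiable_sum: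
  assumes "\<And>i. i \<in> S \<Longrightarrow> cont_differentiable (f i)"
  shows "cont_differentiable (\<lambda>x. \<Sum>i\<in>S. f i x)"
  using assms
  by (induction S rule: infinite_finite_induct)
    (auto intro: cont_differentiable_add cont_differentiable_zero)

lemma cont_differentiable_imp_differentiable:
  "cont_differentiable f \<Longrightarrow> f differentiable (at x)"
  unfolding cont_differentiable_def differentiable_def by blast

section \<open>Gradients and Jacobians: representation, continuity, and the augmented
  Lagrangian\<close>

lemma gradient_eqI:
  assumes "GDERIV f x :> D"
  shows "gradient f x = D"
  unfolding gradient_def
proof (rule the_equality)
  show "GDERIV f x :> D" by (rule assms)
next
  fix E assume "GDERIV f x :> E"
  with assms have "(\<lambda>h. h \<bullet> E) = (\<lambda>h. h \<bullet> D)"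
    unfolding gderiv_def using has_derivative_unique by blast
  then show "E = D" by (metis vector_eq_ldot)
qed

text \<open>The Riesz representer of the derivative, read off on the standard basis. It supplies the
  existence that the definite description in \<open>gradient\<close> takes for granted.\<close>

lemma has_derivative_imp_GDERIV:
  fixes f :: "real^'n::finite \<Rightarrow> real"
  assumes "(f has_derivative f') (at x)"
  shows "GDERIV f x :> (\<chi> i. f' (axis i 1))"
proof -
  interpret f': linear f' using assms by (rule has_derivative_linear)
  have "f' h = h \<bullet> (\<chi> i. f' (axis i 1))" for h
  proof -
    have "f' h = f' (\<Sum>i\<in>UNIV. h $ i *\<^sub>R axis i 1)"
      using basis_expansion[of h] by (simp add: scalar_mult_eq_scaleR)
    also have "\<dots> = (\<Sum>i\<in>UNIV. h $ i * f' (axis i 1))"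
      by (simp add: f'.sum f'.scale)
    finally show ?thesis by (simp add: inner_vec_def)
  qed
  then have "f' = (\<lambda>h. h \<bullet> (\<chi> i. f' (axis i 1)))" by blast
  with assms show ?thesis unfolding gderiv_def by simp
qed

lemma cont_differentiable_imp_GDERIV:
  fixes f :: "real^'n::finite \<Rightarrow> real"
  assumes "cont_differentiable f"
  shows "GDERIV f x :> gradient f x"
proof -
  obtain D where "GDERIV f x :> D"
    using assms has_derivative_imp_GDERIV unfolding cont_differentiable_def by blast
  then show ?thesis by (simp add: gradient_eqI)
qed

lemma tendsto_gradient:
  fixes f :: "real^'n::finite \<Rightarrow> real"
  assumes f: "cont_differentiable f" and z: "(z \<longlongrightarrow> x) F"
  shows "((\<lambda>k. gradient f (z k)) \<longlongrightarrow> gradient f x) F"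
proof -
  obtain f' where f': "\<And>x. (f has_derivative blinfun_apply (f' x)) (at x)"
    and cont: "continuous_on UNIV f'"
    using f unfolding cont_differentiable_def by blast
  have "gradient f y = (\<chi> i. f' y (axis i 1))" for y
    by (intro gradient_eqI has_derivative_imp_GDERIV f')
  moreover have "((\<lambda>k. f' (z k)) \<longlongrightarrow> f' x) F"
    using cont z by (simp add: continuous_on_tendsto_compose)
  ultimately show ?thesis by (auto intro!: tendsto_intros)
qed

lemma tendsto_jacobian:
  fixes f :: "real^'n::finite \<Rightarrow> real^'m::finite"
  assumes f: "cont_differentiable f" and z: "(z \<longlongrightarrow> x) F"
  shows "((\<lambda>k. jacobian f (at (z k))) \<longlongrightarrow> jacobian f (at x)) F"
proof -
  obtain f' where f': "\<And>x. (f has_derivative blinfun_apply (f' x)) (at x)"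
    and cont: "continuous_on UNIV f'"
    using f unfolding cont_differentiable_def by blast
  have "jacobian f (at y) = matrix (f' y)" for y
    using frechet_derivative_at[OF f'] by (simp add: jacobian_def)
  moreover have "((\<lambda>k. f' (z k)) \<longlongrightarrow> f' x) F"
    using cont z by (simp add: continuous_on_tendsto_compose)
  ultimately show ?thesis by (auto simp: matrix_def intro!: tendsto_intros)
qed

text \<open>Links the matrix appearing in \<open>KKT_points\<close> with the family of gradients
  appearing in \<open>regular_point\<close>.\<close>

lemma row_jacobian:
  fixes f :: "real^'n::finite \<Rightarrow> real^'m::finite"
  assumes "f differentiable (at x)"
  shows "row k (jacobian f (at x)) = gradient (\<lambda>y. f y $ k) x"
proof -
  have "(f has_derivative (\<lambda>h. jacobian f (at x) *v h)) (at x)"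
    using assms jacobian_works by blast
  then have "((\<lambda>y. f y $ k) has_derivative (\<lambda>h. (jacobian f (at x) *v h) $ k)) (at x)"
    by (rule bounded_linear.has_derivative[OF bounded_linear_vec_nth])
  then have "GDERIV (\<lambda>y. f y $ k) x :> row k (jacobian f (at x))"
    by (simp add: gderiv_def matrix_vector_mul_component row_def inner_commute vec_lambda_eta)
  then show ?thesis by (simp add: gradient_eqI)
qed

text \<open>The transposed Jacobian maps \<open>v\<close> to the combination of the constraint
  gradients with coefficients \<open>v $ k\<close>, so a trivial kernel is exactly linear
  independence of that family.\<close>

lemma inj_transpose_jacobian:
  fixes H :: "real^'n::finite \<Rightarrow> real^'r::finite"
  assumes "H differentiable (at x)" and reg: "regular_point H x"
  shows "inj ((*v) (transpose (jacobian H (at x))))"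
proof -
  define g where "g = (\<lambda>k. gradient (\<lambda>y. H y $ k) x)"
  have inj: "inj g" and ind: "independent (range g)"
    using reg by (auto simp: regular_point_def g_def)
  have "v = 0" if "transpose (jacobian H (at x)) *v v = 0" for v
  proof -
    have "transpose (jacobian H (at x)) *v v = (\<Sum>k\<in>UNIV. v $ k *\<^sub>R g k)"
      by (simp add: matrix_mult_sum column_transpose row_jacobian[OF assms(1)] g_def
          scalar_mult_eq_scaleR)
    \<comment> \<open>\<open>independent\<close> speaks about a set, so the sum over the index type
      is rewritten as one over \<open>range g\<close>. Injectivity of \<open>g\<close> lets
      \<open>inv g\<close> recover the coefficient belonging to each gradient.\<close>
    also have "\<dots> = (\<Sum>w\<in>range g. v $ inv g w *\<^sub>R w)"
      by (simp add: sum.reindex[OF inj] inj)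
    finally have "(\<Sum>w\<in>range g. v $ inv g w *\<^sub>R w) = 0" using that by simp
    then have "v $ inv g (g k) = 0" for k
      by (intro independentD[OF ind _ subset_refl, of "\<lambda>w. v $ inv g w"]) auto
    then show "v = 0" by (simp add: inj vec_eq_iff)
  qed
  then show ?thesis
    by (simp add: vec.inj_iff_eq_0)
qed

text \<open>The penalty contributes the transposed Jacobian applied to
  \<open>r *\<^sub>R H x\<close>, which merges with the term in \<open>m\<close>. Hence the shifted
  multiplier \<open>m + r *\<^sub>R H x\<close> plays the role of the multiplier in the KKT
  equation.\<close>

lemma gradient_aug_lagrangian:
  fixes J :: "real^'n::finite \<Rightarrow> real" and H :: "real^'n \<Rightarrow> real^'r::finite"
  assumes J: "cont_differentiable J" and H: "cont_differentiable H"
  shows "gradient (aug_lagrangian J H r m) x =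
    gradient J x + transpose (jacobian H (at x)) *v (m + r *\<^sub>R H x)"
proof (rule gradient_eqI)
  let ?D = "\<lambda>h. jacobian H (at x) *v h"
  have dJ: "(J has_derivative (\<lambda>h. h \<bullet> gradient J x)) (at x)"
    using cont_differentiable_imp_GDERIV[OF J] by (simp add: gderiv_def)
  have dH: "(H has_derivative ?D) (at x)"
    using cont_differentiable_imp_differentiable[OF H] jacobian_works by blast
  have "((\<lambda>z. J z + m \<bullet> H z + r / 2 * (H z \<bullet> H z)) has_derivative
      (\<lambda>h. h \<bullet> gradient J x + m \<bullet> ?D h + r / 2 * (H x \<bullet> ?D h + ?D h \<bullet> H x))) (at x)"
    by (intro derivative_intros dJ dH)
  \<comment> \<open>The two equal cross terms cancel the factor 1/2; the adjoint identity then moves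
    the Jacobian to the other side of the inner product.\<close>
  moreover have "m \<bullet> ?D h + r / 2 * (H x \<bullet> ?D h + ?D h \<bullet> H x) =
      h \<bullet> (transpose (jacobian H (at x)) *v (m + r *\<^sub>R H x))" for h
  proof -
    have "m \<bullet> ?D h + r / 2 * (H x \<bullet> ?D h + ?D h \<bullet> H x) = (m + r *\<^sub>R H x) \<bullet> ?D h"
      by (simp add: inner_commute[of "?D h"] inner_add_left)
    also have "\<dots> = (transpose (jacobian H (at x)) *v (m + r *\<^sub>R H x)) \<bullet> h"
      by (simp only: transpose_matrix_vector dot_lmul_matrix)
    finally show ?thesis by (simp add: inner_commute)
  qed
  ultimately show "GDERIV (aug_lagrangian J H r m) x :>
      gradient J x + transpose (jacobian H (at x)) *v (m + r *\<^sub>R H x)"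
    unfolding gderiv_def aug_lagrangian_def power2_norm_eq_inner
    by (simp add: inner_add_right add.assoc)
qed

section \<open>The block-structured problem\<close>

lemma cont_differentiable_objective:
  fixes Jb :: "'b::finite \<Rightarrow> real^'n::finite \<Rightarrow> real"
  assumes "\<And>i. cont_differentiable (\<lambda>x. Jb i (coords (block nb i) x))"
    and "cont_differentiable Q"
  shows "cont_differentiable (objective nb Jb Q)"
proof -
  have "objective nb Jb Q = (\<lambda>z. (\<Sum>i\<in>UNIV. Jb i (coords (block nb i) z)) + Q z)"
    by (rule ext) (rule objective_def)
  then show ?thesis using assms by (simp add: cont_differentiable_add cont_differentiable_sum)
qed

lemma coords_nth: "coords S x $ k = (if k \<in> S then x $ k else 0)"
  by (simp add: coords_def)

text \<open>Each row belongs to exactly one local block or to the coupling block, so the case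
  distinction becomes a sum of truncations with one nonzero contribution per row. In this form
  differentiability is inherited summand by summand.\<close>

lemma constraint_map_eq_sum:
  fixes F :: "'b::finite \<Rightarrow> real^'n::finite \<Rightarrow> real^'r::finite"
  shows "constraint_map nb rb F G z =
    (\<Sum>i\<in>UNIV. coords (block rb (Some i)) (F i (coords (block nb i) z))) + coords (block rb None) (G z)"
proof -
  have "constraint_map nb rb F G z $ k =
    (\<Sum>i\<in>UNIV. coords (block rb (Some i)) (F i (coords (block nb i) z)) $ k)
      + coords (block rb None) (G z) $ k" for k
  proof (cases "rb k")
    case None
    then show ?thesis
      by (simp add: constraint_map_def coords_nth block_def[of rb])
  next
    case (Some j)
    have "(\<Sum>i\<in>UNIV. coords (block rb (Some i)) (F i (coords (block nb i) z)) $ k) =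
        (\<Sum>i\<in>UNIV. if i = j then F i (coords (block nb i) z) $ k else 0)"
      using Some by (intro sum.cong refl) (auto simp: coords_nth block_def[of rb])
    then show ?thesis using Some
      by (simp add: constraint_map_def coords_nth block_def[of rb])
  qed
  then show ?thesis by (simp add: vec_eq_iff)
qed

lemma cont_differentiable_constraint_map:
  fixes F :: "'b::finite \<Rightarrow> real^'n::finite \<Rightarrow> real^'r::finite"
  assumes "\<And>i. cont_differentiable (\<lambda>x. coords (block rb (Some i)) (F i (coords (block nb i) x)))"
    and "cont_differentiable (\<lambda>x. coords (block rb None) (G x))"
  shows "cont_differentiable (constraint_map nb rb F G)"
proof -
  have "constraint_map nb rb F G = (\<lambda>z.
      (\<Sum>i\<in>UNIV. coords (block rb (Some i)) (F i (coords (block nb i) z))) + coords (block rb None) (G z))"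
    by (rule ext) (rule constraint_map_eq_sum)
  then show ?thesis using assms by (simp add: cont_differentiable_add cont_differentiable_sum)
qed

section \<open>Feasibility, uniqueness of isolated multipliers, and limits of approximate KKT
  points\<close>

lemma product_polytope_blkdiag:
  assumes "z \<in> product_polytope nb qb Ab bb"
  shows "blkdiag nb qb Ab *v z \<le> blkstack qb bb"
  unfolding less_eq_vec_def
proof
  fix k
  \<comment> \<open>Row \<open>k\<close> of the block-diagonal matrix sees only the coordinates in
    block \<open>qb k\<close>.\<close>
  have "(blkdiag nb qb Ab *v z) $ k = (Ab (qb k) *v coords (block nb (qb k)) z) $ k"
    by (auto simp: matrix_vector_mult_def blkdiag_def coords_def block_def intro!: sum.cong)
  also have "\<dots> \<le> bb (qb k) $ k"
    using assms by (auto simp: product_polytope_def local_polytope_def block_def[of qb])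
  finally show "(blkdiag nb qb Ab *v z) $ k \<le> blkstack qb bb $ k"
    by (simp add: blkstack_def)
qed

text \<open>For fixed \<open>x\<close> the KKT conditions are affine equations and sign conditions
  in the multipliers. The segment between two multiplier pairs therefore consists of KKT points, and
  a second pair would yield such points arbitrarily close to the isolated one.\<close>

lemma isolated_KKT_multipliers_unique:
  assumes iso: "(x, m, l) isolated_in KKT_points J H A b" and K: "(x, m', l') \<in> KKT_points J H A b"
  shows "m' = m \<and> l' = l"
proof -
  obtain e where "e > 0" and e: "\<And>y. y \<in> KKT_points J H A b \<Longrightarrow> dist (x, m, l) y < e \<Longrightarrow> y = (x, m, l)"
    and K0: "(x, m, l) \<in> KKT_points J H A b"
    using iso unfolding isolated_in_dist_Ex_iff by blast
  define w where "w = (0 :: real^'a, m' - m, l' - l)"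
  \<comment> \<open>The step along the segment is shorter than \<open>e\<close>; the summand
    \<open>e\<close> in the denominator keeps \<open>t\<close> in (0, 1] even when
    \<open>w = 0\<close>.\<close>
  define t where "t = e / (e + norm w)"
  have t: "0 < t" "t \<le> 1" and tw: "t * norm w < e"
    using \<open>e > 0\<close> by (auto simp: t_def field_simps add_pos_nonneg)
  define y where "y = (x, (1 - t) *\<^sub>R m + t *\<^sub>R m', (1 - t) *\<^sub>R l + t *\<^sub>R l')"
  have "y - (x, m, l) = t *\<^sub>R w"
    by (simp add: y_def w_def algebra_simps)
  then have "dist (x, m, l) y < e"
    using tw t by (metis abs_of_pos dist_commute dist_norm norm_scaleR)
  moreover have "y \<in> KKT_points J H A b"
  proof -
    define g where "g = gradient J x"
    define B where "B = transpose (jacobian H (at x))"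
    have 0: "H x = 0" "A *v x \<le> b" "g + B *v m + transpose A *v l = 0" "0 \<le> l" "l \<bullet> (b - A *v x) = 0"
      and 1: "g + B *v m' + transpose A *v l' = 0" "0 \<le> l'" "l' \<bullet> (b - A *v x) = 0"
      using K0 K by (auto simp: KKT_points_def g_def B_def)
    have "g + B *v ((1 - t) *\<^sub>R m + t *\<^sub>R m') + transpose A *v ((1 - t) *\<^sub>R l + t *\<^sub>R l') =
        (1 - t) *\<^sub>R (g + B *v m + transpose A *v l) + t *\<^sub>R (g + B *v m' + transpose A *v l')"
      by (simp add: matrix_vector_right_distrib matrix_vector_mult_scaleR algebra_simps)
    also have "\<dots> = 0" using 0 1 by simp
    finally have "g + B *v ((1 - t) *\<^sub>R m + t *\<^sub>R m') + transpose A *v ((1 - t) *\<^sub>R l + t *\<^sub>R l') = 0" .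
    moreover have "0 \<le> (1 - t) *\<^sub>R l + t *\<^sub>R l'"
      using 0 1 t by (simp add: less_eq_vec_def)
    ultimately show ?thesis
      using 0 1 by (simp add: KKT_points_def y_def g_def B_def inner_add_left)
  qed
  ultimately have "y = (x, m, l)" using e by blast
  then have "t *\<^sub>R w = 0" using \<open>y - (x, m, l) = t *\<^sub>R w\<close> by simp
  then show ?thesis using t by (simp add: w_def zero_prod_def)
qed

text \<open>Only \<open>z\<close> and \<open>lam\<close> are known to converge. Stationarity fixes
  the limit of the transposed Jacobians applied to \<open>m k\<close>, and regularity at
  \<open>x\<close> upgrades this to convergence of \<open>m\<close> itself. The remaining conditions
  are closed and survive the limit.\<close>

lemma KKT_point_limit:
  fixes J :: "real^'n::finite \<Rightarrow> real" and H :: "real^'n \<Rightarrow> real^'r::finite"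
    and A :: "real^'n^'q::finite"
  assumes J: "cont_differentiable J" and H: "cont_differentiable H"
    and z: "z \<longlonglongrightarrow> x" and reg: "regular_point H x" and l: "lam \<longlonglongrightarrow> l" and d: "d \<longlonglongrightarrow> 0"
    and feas: "\<And>k. A *v z k \<le> b" and nonneg: "\<And>k. 0 \<le> lam k"
    and compl: "\<And>k. lam k \<bullet> (b - A *v z k) = 0"
    and stat: "\<And>k. gradient J (z k) + transpose (jacobian H (at (z k))) *v m k
          + transpose A *v lam k = - d k"
  shows "\<exists>m0. m \<longlonglongrightarrow> m0 \<and> (x, m0, l) \<in> KKT_points J H A b"
proof -
  let ?B = "\<lambda>z. transpose (jacobian H (at z))"
  have B: "(\<lambda>k. ?B (z k)) \<longlonglongrightarrow> ?B x"
    by (intro tendsto_transpose tendsto_jacobian H z)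
  \<comment> \<open>Every term on the right has a known limit.\<close>
  have Bm: "?B (z k) *v m k = - d k - gradient J (z k) - transpose A *v lam k" for k
    using stat[of k] by (simp add: algebra_simps eq_neg_iff_add_eq_0)
  have lim: "(\<lambda>k. ?B (z k) *v m k) \<longlonglongrightarrow> - 0 - gradient J x - transpose A *v l"
    unfolding Bm by (intro tendsto_intros tendsto_matrix_vector_mult tendsto_gradient J z l d)
  have "inj ((*v) (?B x))"
    by (intro inj_transpose_jacobian cont_differentiable_imp_differentiable H reg)
  from tendsto_of_matrix_vector_mult_tendsto[OF B this lim]
  obtain m0 where m0: "m \<longlonglongrightarrow> m0" by blast
  have "(\<lambda>k. ?B (z k) *v m k) \<longlonglongrightarrow> ?B x *v m0"
    by (intro tendsto_matrix_vector_mult B m0)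
  from LIMSEQ_unique[OF this lim] have "gradient J x + ?B x *v m0 + transpose A *v l = 0"
    by simp
  moreover have Az: "(\<lambda>k. A *v z k) \<longlonglongrightarrow> A *v x"
    by (intro tendsto_matrix_vector_mult tendsto_const z)
  have "A *v x \<le> b"
    unfolding less_eq_vec_def
    using feas LIMSEQ_le_const2[OF tendsto_vec_nth[OF Az]] by (auto simp: less_eq_vec_def)
  moreover have "0 \<le> l"
    using nonneg LIMSEQ_le_const[OF tendsto_vec_nth[OF l]] by (auto simp: less_eq_vec_def)
  moreover have "(\<lambda>k. lam k \<bullet> (b - A *v z k)) \<longlonglongrightarrow> l \<bullet> (b - A *v x)"
    by (intro tendsto_intros l Az)
  then have "l \<bullet> (b - A *v x) = 0"
    by (simp add: compl LIMSEQ_const_iff)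
  \<comment> \<open>Feasibility for the equality constraints is part of regularity of the limit
    point.\<close>
  moreover have "H x = 0" using reg by (simp add: regular_point_def)
  ultimately show ?thesis using m0 by (auto simp: KKT_points_def)
qed

section \<open>Convergence of the iterates and of the multiplier estimates\<close>

theorem theorem1:
  fixes nb :: "'n::finite \<Rightarrow> 'b::finite"
    and rb :: "'r::finite \<Rightarrow> 'b option"
    and qb :: "'q::finite \<Rightarrow> 'b"
    and Jb :: "'b \<Rightarrow> real^'n \<Rightarrow> real"
    and Q :: "real^'n \<Rightarrow> real"
    and F :: "'b \<Rightarrow> real^'n \<Rightarrow> real^'r"
    and G :: "real^'n \<Rightarrow> real^'r"
    and Ab :: "'b \<Rightarrow> real^'n^'q"
    and bb :: "'b \<Rightarrow> real^'q"
    and J :: "real^'n \<Rightarrow> real"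
    and H :: "real^'n \<Rightarrow> real^'r"
    and A :: "real^'n^'q"
    and b :: "real^'q"
    and Z :: "(real^'n) set"
    and zs :: "real^'n" and mus :: "real^'r" and lams :: "real^'q"
    and \<kappa> \<nu> :: real
    and z d :: "nat \<Rightarrow> real^'n"
    and \<mu> :: "nat \<Rightarrow> real^'r"
    and lam :: "nat \<Rightarrow> real^'q"
    and \<rho> :: "nat \<Rightarrow> real"
  assumes J_eq: "J = objective nb Jb Q"
    and H_eq: "H = constraint_map nb rb F G"
    and A_eq: "A = blkdiag nb qb Ab"
    and b_eq: "b = blkstack qb bb"
    and Z_eq: "Z = product_polytope nb qb Ab bb"
    and Jb_smooth: "\<And>i. smooth_semialgebraic (\<lambda>x. Jb i (coords (block nb i) x))"
    and Q_smooth: "smooth_semialgebraic Q"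
    and F_smooth: "\<And>i. smooth_semialgebraic
          (\<lambda>x. coords (block rb (Some i)) (F i (coords (block nb i) x)))"
    and G_smooth: "smooth_semialgebraic (\<lambda>x. coords (block rb None) (G x))"
    and polytope_bounded: "\<And>i. bounded (local_polytope nb qb Ab bb i)"
    and isolated_KKT: "(zs, mus, lams) isolated_in KKT_points J H A b"
    and zs_regular: "regular_point H zs"
    and second_order: "\<And>p. p \<noteq> 0 \<Longrightarrow> jacobian H (at zs) *v p = 0 \<Longrightarrow>
          (\<forall>k\<in>active_set A b zs. (A *v p) $ k = 0) \<Longrightarrow>
          p \<bullet> (hessian (lagrangian J H A b mus lams) zs *v p) > 0"
    and strict_complementarity: "\<And>k. k \<in> active_set A b zs \<Longrightarrow> lams $ k > 0"
    and nu_pos: "\<nu> > 0"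
    and nu: "critical_points J H A b \<inter> ball zs \<nu> = {zs}"
    and kappa_pos: "\<kappa> > 0"
    and kappa: "\<exists>\<delta> \<rho>bar. \<delta> > 0 \<and> \<rho>bar > 0 \<and>
          (\<forall>m r. norm (m - mus) \<le> \<delta> * r \<and> r \<ge> \<rho>bar \<longrightarrow>
             (\<exists>!x. x \<in> Z \<and> norm (x - zs) < \<kappa> \<and>
                (\<forall>y\<in>Z. norm (y - zs) < \<kappa> \<longrightarrow> aug_lagrangian J H r m x \<le> aug_lagrangian J H r m y)))"
    and no_critical_on_sphere: "critical_points J H A b \<inter> sphere zs (min \<kappa> \<nu>) = {}"
    and z_in: "\<And>k. z k \<in> Z \<inter> closure (ball zs (min \<kappa> \<nu>))"
    and inexact: "\<And>k. - gradient (aug_lagrangian J H (\<rho> k) (\<mu> k)) (z k)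
          \<in> (\<lambda>v. v + d k) ` normal_cone Z (z k)"
    and rho_pos: "\<And>k. \<rho> k > 0"
    and rho_inc: "incseq \<rho>"
    and rho_lim: "filterlim \<rho> at_top sequentially"
    and mu_bounded: "bounded (range \<mu>)"
    and lam_bounded: "bounded (range lam)"
    and lam_eq: "\<And>k. - gradient (aug_lagrangian J H (\<rho> k) (\<mu> k)) (z k) - d k = transpose A *v lam k"
    and lam_nonneg: "\<And>k. 0 \<le> lam k"
    and lam_compl: "\<And>k. lam k \<bullet> (b - A *v z k) = 0"
    and d_lim: "(\<lambda>k. norm (d k)) \<longlonglongrightarrow> 0"
    and limit_points_regular: "\<And>x. limit_point_of_seq z x \<Longrightarrow> regular_point H x"
  shows "z \<longlonglongrightarrow> zs \<and> (\<lambda>k. \<mu> k + \<rho> k *\<^sub>R H (z k)) \<longlonglongrightarrow> mus"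
proof -
  let ?R = "min \<kappa> \<nu>"
  let ?mt = "\<lambda>k. \<mu> k + \<rho> k *\<^sub>R H (z k)"
  have R: "?R > 0" using kappa_pos nu_pos by simp
  have J: "cont_differentiable J"
    unfolding J_eq using Jb_smooth Q_smooth
    by (intro cont_differentiable_objective smooth_semialgebraic_imp_cont_differentiable)
  have H: "cont_differentiable H"
    unfolding H_eq using F_smooth G_smooth
    by (intro cont_differentiable_constraint_map smooth_semialgebraic_imp_cont_differentiable)
  \<comment> \<open>The closure of an open ball of positive radius is the closed ball.\<close>
  have z_ball: "z k \<in> cball zs ?R" for k
    using z_in[of k] R by simp
  have feas: "A *v z k \<le> b" for k
    using z_in[of k] product_polytope_blkdiag unfolding A_eq b_eq Z_eq by blast
  have d: "d \<longlonglongrightarrow> 0" using d_lim by (simp add: tendsto_norm_zero_iff)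
  have stat: "gradient J (z k) + transpose (jacobian H (at (z k))) *v ?mt k
      + transpose A *v lam k = - d k" for k
    using lam_eq[of k, symmetric] by (simp add: gradient_aug_lagrangian[OF J H])
  \<comment> \<open>Taking \<open>z\<close> and \<open>lam\<close> as a pair gives one common
    convergent subsequence. The estimates \<open>?mt\<close> cannot join it, since
    \<open>\<rho> k *\<^sub>R H (z k)\<close> is not yet known to be bounded.\<close>
  have "bounded (range (\<lambda>k. (z k, lam k)))"
  proof (rule bounded_subset)
    show "bounded (cball zs ?R \<times> range lam)"
      by (intro bounded_Times bounded_cball lam_bounded)
  qed (use z_ball in auto)
  note bnd = this
  \<comment> \<open>The subsequence criterion is prepared for the pair, so that both limits are
    identified along the same extraction.\<close>
  have "\<exists>t. strict_mono t \<and> (\<lambda>k. (z (s (t k)), ?mt (s (t k)))) \<longlonglongrightarrow> (zs, mus)"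
    if s: "strict_mono s" for s :: "nat \<Rightarrow> nat"
  proof -
    have "bounded (range ((\<lambda>k. (z k, lam k)) \<circ> s))"
      using bnd by (rule bounded_subset) auto
    then obtain xl t where t: "strict_mono t"
      and conv: "(((\<lambda>k. (z k, lam k)) \<circ> s) \<circ> t) \<longlonglongrightarrow> xl"
      using bounded_imp_convergent_subsequence by blast
    obtain x l where xl: "xl = (x, l)" by fastforce
    define u where "u = s \<circ> t"
    \<comment> \<open>The composed extraction makes \<open>x\<close> a limit point of the original
      sequence \<open>z\<close>, to which the regularity assumption applies.\<close>
    have u: "strict_mono u" unfolding u_def using s t by (rule strict_mono_o)
    have zx: "(\<lambda>k. z (u k)) \<longlonglongrightarrow> x" and ll: "(\<lambda>k. lam (u k)) \<longlonglongrightarrow> l"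
      using tendsto_fst[OF conv] tendsto_snd[OF conv] by (simp_all add: xl u_def o_def)
    have "regular_point H x"
      using limit_points_regular zx u unfolding limit_point_of_seq_def o_def by blast
    moreover have "(\<lambda>k. d (u k)) \<longlonglongrightarrow> 0"
      using LIMSEQ_subseq_LIMSEQ[OF d u] by (simp add: o_def)
    ultimately obtain m0 where m0: "(\<lambda>k. ?mt (u k)) \<longlonglongrightarrow> m0"
      and K: "(x, m0, l) \<in> KKT_points J H A b"
      using KKT_point_limit[OF J H zx _ ll _ feas lam_nonneg lam_compl stat] by blast
    have crit: "x \<in> critical_points J H A b"
      using K unfolding critical_points_def by force
    \<comment> \<open>The limit stays in the closed ball but, being critical, avoids its boundary
      sphere. It thus lies in the open ball of radius \<open>\<nu>\<close>, whose only critical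
      point is \<open>zs\<close>.\<close>
    have "x \<in> cball zs ?R"
      using closed_sequentially[OF closed_cball _ zx] z_ball by blast
    moreover have "x \<notin> sphere zs ?R" using crit no_critical_on_sphere by blast
    ultimately have "x \<in> ball zs \<nu>" by auto
    then have "x = zs" using crit nu by blast
    then have "m0 = mus" using isolated_KKT_multipliers_unique[OF isolated_KKT] K by blast
    show ?thesis
      using tendsto_Pair[OF zx m0] t unfolding \<open>x = zs\<close> \<open>m0 = mus\<close> by (auto simp: u_def)
  qed
  then have "(\<lambda>k. (z k, ?mt k)) \<longlonglongrightarrow> (zs, mus)"
    by (rule LIMSEQ_of_subsequences)
  from tendsto_fst[OF this] tendsto_snd[OF this] show ?thesis by simp
qed

end
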